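(* Let $X$ be a hyperbolic Riemann surface, and let $F\in\mathrm{Hol}(X,X)$ be a holomorphic self-map of $X$ such that the sequence of iterates $\{F^\nu\}$ is compactly divergent. Then there exists a sequence $\{\mathcal{U}_\nu\}_{\nu\in\mathbb{N}}$ of neighbourhoods $\mathcal{U}_\nu\subset\mathrm{Hol}(X,X)$ of $F$ such that, if $f_\nu\in\mathcal{U}_\nu$ for all $\nu\in\mathbb{N}$, then the left iterated function system $\{L_\nu\}$ generated by $\{f_\nu\}$, given by $L_\nu=f_\nu\circ f_{\nu-1}\circ\cdots\circ f_0$, is compactly divergent. Furthermore, if $X\subset\widehat{X}$ is a hyperbolic domain in a compact Riemann surface $\widehat{X}$ and $\{F^\nu\}$ converges to a point $\tau\in\partial X$ (boundary in $\widehat X$), then $\{L_\nu\}$ converges to $\tau$.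
   Context: A Riemann surface is hyperbolic if its universal covering is the unit disk $\mathbb{D}$. A hyperbolic domain in a compact Riemann surface $\widehat{X}$ is a domain $X\subset\widehat{X}$ which is a hyperbolic Riemann surface on its own. $\mathrm{Hol}(X,X)$ denotes the space of holomorphic self-maps of $X$, endowed with the compact-open topology (equivalently, uniform convergence on compact subsets). $F^\nu$ is the $\nu$-th iterate of $F$ under composition. A sequence $\{g_\nu\}\subset\mathrm{Hol}(X,X)$ is compactly divergent if for all compact sets $K, L\subseteq X$ there is $\nu_0\in\mathbb{N}$ such that $g_\nu(K)\cap L=\varnothing$ for all $\nu\ge\nu_0$. Convergence of a sequence of self-maps of $X\subset\widehat X$ to a point $\tau\in\partial X$ means convergence, uniformly on compact subsets of $X$, to the constant map $\tau$, as maps into $\widehat{X}$. By convention, the maps generating an iterated function system are all different from the identity $\mathrm{id}_X$. *)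

theory Defs
  imports "HOL-Analysis.Analysis"
begin

text \<open>
  A chart \<open>(U, \<phi>)\<close> is an open set together with a complex coordinate; the values of \<open>\<phi>\<close>
  outside \<open>U\<close> are irrelevant. Atlases are not required to be maximal.
\<close>

type_synonym 'a chart = "'a set \<times> ('a \<Rightarrow> complex)"

record 'a surface =
  topo :: "'a topology"
  atlas :: "'a chart set"

abbreviation points :: "'a surface \<Rightarrow> 'a set" where
  "points X \<equiv> topspace (topo X)"

definition chart_on :: "'a topology \<Rightarrow> 'a chart \<Rightarrow> bool" where
  "chart_on T = (\<lambda>(U, \<phi>). openin T U \<and> open (\<phi> ` U) \<and>
     homeomorphic_map (subtopology T U) (top_of_set (\<phi> ` U)) \<phi>)"

definition compatible :: "'a chart \<Rightarrow> 'a chart \<Rightarrow> bool" where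
  "compatible = (\<lambda>(U, \<phi>) (V, \<psi>).
     (\<psi> \<circ> inv_into U \<phi>) holomorphic_on \<phi> ` (U \<inter> V) \<and>
     (\<phi> \<circ> inv_into V \<psi>) holomorphic_on \<psi> ` (U \<inter> V))"

text \<open>Second countability is omitted, being automatic by Rado's theorem.\<close>

definition riemann_surface :: "'a surface \<Rightarrow> bool" where
  "riemann_surface X \<longleftrightarrow>
     points X \<noteq> {} \<and> connected_space (topo X) \<and> Hausdorff_space (topo X) \<and>
     (\<forall>c\<in>atlas X. chart_on (topo X) c) \<and>
     (\<Union>c\<in>atlas X. fst c) = points X \<and>
     (\<forall>c\<in>atlas X. \<forall>d\<in>atlas X. compatible c d)"

definition holomorphic_map :: "'a surface \<Rightarrow> 'b surface \<Rightarrow> ('a \<Rightarrow> 'b) \<Rightarrow> bool" where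
  "holomorphic_map X Y f \<longleftrightarrow> continuous_map (topo X) (topo Y) f \<and>
     (\<forall>(U, \<phi>)\<in>atlas X. \<forall>(V, \<psi>)\<in>atlas Y.
        (\<psi> \<circ> f \<circ> inv_into U \<phi>) holomorphic_on \<phi> ` (U \<inter> f -` V))"

text \<open>
  The space of holomorphic maps; extensionality makes equality of elements coincide with
  equality of maps on the surface.
\<close>

definition Hol :: "'a surface \<Rightarrow> 'b surface \<Rightarrow> ('a \<Rightarrow> 'b) set" where
  "Hol X Y = {f \<in> extensional (points X). holomorphic_map X Y f}"

definition Hol_topology :: "'a surface \<Rightarrow> 'b surface \<Rightarrow> ('a \<Rightarrow> 'b) topology" where
  "Hol_topology X Y = topology_generated_by
     {{f \<in> Hol X Y. f ` K \<subseteq> V} | K V. compactin (topo X) K \<and> openin (topo Y) V}"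

text \<open>The set \<open>\<V>\<close> below is the family of sheets over the evenly covered set \<open>T\<close>.\<close>

definition covering_map :: "'b topology \<Rightarrow> 'a topology \<Rightarrow> ('b \<Rightarrow> 'a) \<Rightarrow> bool" where
  "covering_map Y X p \<longleftrightarrow> continuous_map Y X p \<and> p ` topspace Y = topspace X \<and>
     (\<forall>x\<in>topspace X. \<exists>T. openin X T \<and> x \<in> T \<and>
        (\<exists>\<V>. \<Union>\<V> = {y \<in> topspace Y. p y \<in> T} \<and> (\<forall>V\<in>\<V>. openin Y V) \<and> disjoint \<V> \<and>
           (\<forall>V\<in>\<V>. homeomorphic_map (subtopology Y V) (subtopology X T) p)))"

definition simply_connected_space :: "'a topology \<Rightarrow> bool" where
  "simply_connected_space T \<longleftrightarrow> path_connected_space T \<and>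
     (\<forall>g. continuous_map (top_of_set (sphere (0::complex) 1)) T g \<longrightarrow>
        (\<exists>c. homotopic_with (\<lambda>_. True) (top_of_set (sphere 0 1)) T g (\<lambda>_. c)))"

definition universal_covering :: "'b surface \<Rightarrow> 'a surface \<Rightarrow> ('b \<Rightarrow> 'a) \<Rightarrow> bool" where
  "universal_covering Y X p \<longleftrightarrow> riemann_surface Y \<and> simply_connected_space (topo Y) \<and>
     covering_map (topo Y) (topo X) p \<and> holomorphic_map Y X p"

definition unit_disk :: "complex surface" where
  "unit_disk = \<lparr>topo = top_of_set (ball 0 1), atlas = {(ball 0 1, id)}\<rparr>"

text \<open>
  A universal covering by a surface biholomorphic to the disk becomes one by the disk itself
  after composition with the biholomorphism.
\<close>

definition hyperbolic :: "'a surface \<Rightarrow> bool" where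
  "hyperbolic X \<longleftrightarrow> riemann_surface X \<and> (\<exists>p. universal_covering unit_disk X p)"

text \<open>
  \<open>X\<close> is a domain in \<open>Y\<close>: an open subset with the induced topology and the induced complex
  structure, whichever atlas of \<open>X\<close> represents the latter. (Connectedness is part of
  \<^const>\<open>riemann_surface\<close>.)
\<close>

definition domain_in :: "'a surface \<Rightarrow> 'a surface \<Rightarrow> bool" where
  "domain_in X Y \<longleftrightarrow> riemann_surface X \<and> riemann_surface Y \<and>
     openin (topo Y) (points X) \<and> topo X = subtopology (topo Y) (points X) \<and>
     (\<forall>c\<in>atlas X. \<forall>d\<in>atlas Y. compatible c d)"

definition iterates :: "'a surface \<Rightarrow> ('a \<Rightarrow> 'a) \<Rightarrow> nat \<Rightarrow> 'a \<Rightarrow> 'a" where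
  "iterates X F \<nu> = restrict (F ^^ \<nu>) (points X)"

primrec left_ifs :: "'a surface \<Rightarrow> (nat \<Rightarrow> 'a \<Rightarrow> 'a) \<Rightarrow> nat \<Rightarrow> 'a \<Rightarrow> 'a" where
  "left_ifs X f 0 = f 0"
| "left_ifs X f (Suc \<nu>) = compose (points X) (f (Suc \<nu>)) (left_ifs X f \<nu>)"

definition compactly_divergent :: "'a surface \<Rightarrow> (nat \<Rightarrow> 'a \<Rightarrow> 'a) \<Rightarrow> bool" where
  "compactly_divergent X g \<longleftrightarrow>
     (\<forall>K L. compactin (topo X) K \<and> compactin (topo X) L \<longrightarrow>
        (\<exists>\<nu>\<^sub>0. \<forall>\<nu>\<ge>\<nu>\<^sub>0. g \<nu> ` K \<inter> L = {}))"

text \<open>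
  Convergence of maps \<open>X \<rightarrow> Y\<close>, uniformly on compact subsets of \<open>X\<close>, to the constant map \<open>\<tau>\<close>:
  convergence in the compact-open topology.
\<close>

definition converges_to_point ::
  "'a surface \<Rightarrow> 'b surface \<Rightarrow> (nat \<Rightarrow> 'a \<Rightarrow> 'b) \<Rightarrow> 'b \<Rightarrow> bool" where
  "converges_to_point X Y g \<tau> \<longleftrightarrow>
     limitin (Hol_topology X Y) g (restrict (\<lambda>_. \<tau>) (points X)) sequentially"

end

theory Submission
  imports Defs "HOL-Complex_Analysis.Riemann_Mapping"
begin

text \<open>
  No metric is used. As \<open>F\<close> is not constant, every iterate of \<open>F\<close> is an open map, so if \<open>f\<close> is close
  to \<open>F\<close> on the compact set \<open>F\<^sup>k(C)\<close>, then \<open>f(F\<^sup>k(C))\<close> lies in \<open>F\<^sup>k\<^sup>+\<^sup>1(C')\<close> for a compact set \<open>C'\<close>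
  slightly larger than \<open>C\<close>. Enlarging by less and less in each step gives
  \<open>L\<^sub>n\<^sub>+\<^sub>k(K) \<subseteq> F\<^sup>k(C)\<close> for all \<open>k\<close> with one compact set \<open>C\<close>, and both claims follow from this inclusion.

  Infinitely many compact sets \<open>K\<close> have to be treated with neighbourhoods defined by finitely many
  conditions: the \<open>n\<close>-th set of an exhaustion imposes conditions only on \<open>f\<^sub>\<nu>\<close> with \<open>\<nu> > n\<close>, and
  \<open>L\<^sub>n(K)\<close> has to lie in a compact set that does not depend on \<open>f\<^sub>0, \<dots>, f\<^sub>n\<close>. Hyperbolicity gives
  this: lifting self-maps of \<open>X\<close> to the disk, the Schwarz--Pick lemma bounds all maps close to \<open>F\<close>
  uniformly on compact sets.
\<close>

section \<open>Holomorphic maps and the compact-open topology\<close>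

lemma chart_on_openin: "chart_on T (U, \<phi>) \<Longrightarrow> openin T U"
  by (simp add: chart_on_def)

lemma chart_on_inj: "chart_on T (U, \<phi>) \<Longrightarrow> inj_on \<phi> U"
  unfolding chart_on_def
  by (auto dest!: homeomorphic_imp_injective_map dest: openin_subset simp: Int_absorb1)

lemma chart_on_open_image:
  assumes c: "chart_on T (U, \<phi>)" and O: "openin T S" "S \<subseteq> U"
  shows "open (\<phi> ` S)"
proof -
  have "open_map (subtopology T U) (top_of_set (\<phi> ` U)) \<phi>"
    using c homeomorphic_imp_open_map by (auto simp: chart_on_def)
  moreover have "openin (subtopology T U) S"
    unfolding openin_subtopology using O by blast
  ultimately have "openin (top_of_set (\<phi> ` U)) (\<phi> ` S)"
    by (simp add: open_map_def)
  then show ?thesis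
    using c by (auto simp: chart_on_def intro: openin_open_trans)
qed

lemma riemann_surface_chart:
  "riemann_surface X \<Longrightarrow> c \<in> atlas X \<Longrightarrow> chart_on (topo X) c"
  by (simp add: riemann_surface_def)

lemma riemann_surface_chart_exists:
  assumes "riemann_surface X" "x \<in> points X"
  obtains U \<phi> where "(U, \<phi>) \<in> atlas X" "x \<in> U"
proof -
  have "x \<in> (\<Union>c\<in>atlas X. fst c)" using assms by (simp add: riemann_surface_def)
  then show thesis using that by auto
qed

text \<open>Differentiability at a point sees only an open neighbourhood of it. Coordinate
  expressions can thus be treated near one point at a time, with charts chosen for that
  point.\<close>

lemma holomorphic_on_local:
  assumes "\<And>w. w \<in> A \<Longrightarrow> \<exists>B. open B \<and> w \<in> B \<and> f holomorphic_on B"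
  shows "f holomorphic_on A"
  unfolding holomorphic_on_def
proof
  fix w assume "w \<in> A"
  then obtain B where "open B" "w \<in> B" "f holomorphic_on B" using assms by blast
  then have "f field_differentiable at w"
    by (simp add: holomorphic_on_imp_differentiable_at)
  then show "f field_differentiable at w within A"
    by (rule field_differentiable_at_within)
qed

section \<open>Holomorphic maps between surfaces\<close>

lemma holomorphic_mapD:
  assumes "holomorphic_map X Y f" "(U, \<phi>) \<in> atlas X" "(V, \<psi>) \<in> atlas Y"
  shows "(\<psi> \<circ> f \<circ> inv_into U \<phi>) holomorphic_on \<phi> ` (U \<inter> f -` V)"
  using assms by (auto simp: holomorphic_map_def)

text \<open>Near a point \<open>x\<close> the coordinate expression factors through a chart of
  \<open>Y\<close> around \<open>f x\<close>. That chart varies with \<open>x\<close>, so holomorphy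
  is shown locally.\<close>

lemma holomorphic_map_compose:
  assumes X: "riemann_surface X" and Y: "riemann_surface Y"
    and f: "holomorphic_map X Y f" and g: "holomorphic_map Y Z g"
    and Z: "\<And>c. c \<in> atlas Z \<Longrightarrow> openin (topo Z) (fst c)"
  shows "holomorphic_map X Z (g \<circ> f)"
  unfolding holomorphic_map_def
proof safe
  show "continuous_map (topo X) (topo Z) (g \<circ> f)"
    using f g continuous_map_compose by (auto simp: holomorphic_map_def)
next
  fix U \<phi> V \<psi> assume U: "(U, \<phi>) \<in> atlas X" and V: "(V, \<psi>) \<in> atlas Z"
  have cU: "chart_on (topo X) (U, \<phi>)" using X U riemann_surface_chart by blast
  show "(\<psi> \<circ> (g \<circ> f) \<circ> inv_into U \<phi>) holomorphic_on \<phi> ` (U \<inter> (g \<circ> f) -` V)"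
  proof (rule holomorphic_on_local)
    fix w assume "w \<in> \<phi> ` (U \<inter> (g \<circ> f) -` V)"
    then obtain x where x: "x \<in> U" "g (f x) \<in> V" "w = \<phi> x" by auto
    have UX: "U \<subseteq> points X" using cU chart_on_openin openin_subset by blast
    have cf: "continuous_map (topo X) (topo Y) f" and cg: "continuous_map (topo Y) (topo Z) g"
      using f g by (auto simp: holomorphic_map_def)
    then have "f x \<in> points Y" using x UX by (auto simp: continuous_map_def)
    then obtain W \<kappa> where W: "(W, \<kappa>) \<in> atlas Y" "f x \<in> W"
      using riemann_surface_chart_exists[OF Y] by metis
    have cW: "chart_on (topo Y) (W, \<kappa>)" using Y W riemann_surface_chart by blast
    have WY: "W \<subseteq> points Y" using cW chart_on_openin openin_subset by blast
    define S where "S = W \<inter> g -` V"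
    have S': "S = W \<inter> {y \<in> points Y. g y \<in> V}" using WY by (auto simp: S_def)
    have oS: "openin (topo Y) S" unfolding S'
      using openin_continuous_map_preimage[OF cg] Z[OF V]
      by (intro openin_Int chart_on_openin[OF cW]) simp
    define R where "R = U \<inter> f -` S"
    have R': "R = U \<inter> {x \<in> points X. f x \<in> S}" using UX by (auto simp: R_def)
    have oR: "openin (topo X) R" unfolding R'
      by (intro openin_Int chart_on_openin[OF cU] openin_continuous_map_preimage[OF cf oS])
    have oB: "open (\<phi> ` R)" using chart_on_open_image[OF cU oR] by (auto simp: R_def)
    have h1: "(\<kappa> \<circ> f \<circ> inv_into U \<phi>) holomorphic_on \<phi> ` R"
      by (rule holomorphic_on_subset[OF holomorphic_mapD[OF f U W(1)]]) (auto simp: R_def S_def)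
    have h2: "(\<psi> \<circ> g \<circ> inv_into W \<kappa>) holomorphic_on \<kappa> ` S"
      using holomorphic_mapD[OF g W(1) V] by (simp add: S_def)
    have "((\<psi> \<circ> g \<circ> inv_into W \<kappa>) \<circ> (\<kappa> \<circ> f \<circ> inv_into U \<phi>)) holomorphic_on \<phi> ` R"
      by (rule holomorphic_on_compose_gen[OF h1 h2])
        (auto simp: R_def inv_into_f_f[OF chart_on_inj[OF cU]])
    then have "(\<psi> \<circ> (g \<circ> f) \<circ> inv_into U \<phi>) holomorphic_on \<phi> ` R"
      by (rule holomorphic_transform)
        (auto simp: R_def S_def inv_into_f_f[OF chart_on_inj[OF cU]] inv_into_f_f[OF chart_on_inj[OF cW]])
    moreover have "w \<in> \<phi> ` R" using x W by (auto simp: R_def S_def)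
    ultimately show "\<exists>B. open B \<and> w \<in> B \<and> (\<psi> \<circ> (g \<circ> f) \<circ> inv_into U \<phi>) holomorphic_on B"
      using oB by blast
  qed
qed

text \<open>Chart domains lie in \<open>points X\<close>, so values elsewhere do not matter. This
  passes from \<open>g \<circ> f\<close> to the extensional
  \<open>compose (points X) g f\<close>.\<close>

lemma holomorphic_map_cong:
  assumes X: "riemann_surface X" and fg: "\<And>x. x \<in> points X \<Longrightarrow> f x = g x"
    and f: "holomorphic_map X Y f"
  shows "holomorphic_map X Y g"
  unfolding holomorphic_map_def
proof safe
  show "continuous_map (topo X) (topo Y) g"
    using f fg continuous_map_eq unfolding holomorphic_map_def by blast
next
  fix U \<phi> V \<psi> assume U: "(U, \<phi>) \<in> atlas X" and V: "(V, \<psi>) \<in> atlas Y"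
  have cU: "chart_on (topo X) (U, \<phi>)" using X U riemann_surface_chart by blast
  then have UX: "U \<subseteq> points X" using chart_on_openin openin_subset by blast
  have "U \<inter> f -` V = U \<inter> g -` V" using fg UX by auto
  then have "(\<psi> \<circ> f \<circ> inv_into U \<phi>) holomorphic_on \<phi> ` (U \<inter> g -` V)"
    using holomorphic_mapD[OF f U V] by simp
  then show "(\<psi> \<circ> g \<circ> inv_into U \<phi>) holomorphic_on \<phi> ` (U \<inter> g -` V)"
    by (rule holomorphic_transform) (use fg UX in \<open>auto simp: inv_into_f_f[OF chart_on_inj[OF cU]]\<close>)
qed

lemma riemann_surface_fst_chart_openin:
  "riemann_surface X \<Longrightarrow> c \<in> atlas X \<Longrightarrow> openin (topo X) (fst c)"
  by (metis chart_on_openin prod.collapse riemann_surface_chart)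

lemma Hol_compose:
  assumes X: "riemann_surface X" and Y: "riemann_surface Y" and Z: "riemann_surface Z"
    and f: "f \<in> Hol X Y" and g: "g \<in> Hol Y Z"
  shows "compose (points X) g f \<in> Hol X Z"
proof -
  have "holomorphic_map X Z (g \<circ> f)"
    using assms by (intro holomorphic_map_compose[OF X Y]) (auto simp: Hol_def riemann_surface_fst_chart_openin)
  then have "holomorphic_map X Z (compose (points X) g f)"
    by (rule holomorphic_map_cong[OF X, rotated]) (simp add: compose_def)
  then show ?thesis by (simp add: Hol_def)
qed

lemma domain_in_inclusion:
  assumes "domain_in X Y"
  shows "holomorphic_map X Y id"
  unfolding holomorphic_map_def
proof safe
  have "topo X = subtopology (topo Y) (points X)" using assms by (simp add: domain_in_def)
  then show "continuous_map (topo X) (topo Y) id"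
    by (metis continuous_map_from_subtopology continuous_map_id)
next
  fix U \<phi> V \<psi> assume "(U, \<phi>) \<in> atlas X" and "(V, \<psi>) \<in> atlas Y"
  then have "compatible (U, \<phi>) (V, \<psi>)" using assms by (auto simp: domain_in_def)
  then show "(\<psi> \<circ> id \<circ> inv_into U \<phi>) holomorphic_on \<phi> ` (U \<inter> id -` V)"
    by (simp add: compatible_def)
qed

text \<open>Convergence to a boundary point is formulated in the larger space
  \<open>Hol X Y\<close>, so self-maps of the domain have to be elements of that space.\<close>

lemma domain_in_Hol_subset:
  assumes "domain_in X Y"
  shows "Hol X X \<subseteq> Hol X Y"
proof
  fix f assume f: "f \<in> Hol X X"
  have "holomorphic_map X Y (id \<circ> f)"
    using assms f domain_in_inclusion[OF assms] by (intro holomorphic_map_compose[of X X])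
      (auto simp: domain_in_def Hol_def riemann_surface_fst_chart_openin)
  with f show "f \<in> Hol X Y" by (simp add: Hol_def)
qed

section \<open>The compact-open topology\<close>

lemma Hol_continuous_map: "f \<in> Hol X Y \<Longrightarrow> continuous_map (topo X) (topo Y) f"
  by (simp add: Hol_def holomorphic_map_def)

lemma Hol_in_points: "f \<in> Hol X Y \<Longrightarrow> x \<in> points X \<Longrightarrow> f x \<in> points Y"
  using Hol_continuous_map by (fastforce simp: continuous_map_def)

lemma openin_Hol_topology_subbasis:
  assumes "compactin (topo X) K" "openin (topo Y) V"
  shows "openin (Hol_topology X Y) {f \<in> Hol X Y. f ` K \<subseteq> V}"
  unfolding Hol_topology_def using assms by (intro topology_generated_by_Basis) blast

lemma topspace_Hol_topology: "topspace (Hol_topology X Y) = Hol X Y"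
proof
  show "topspace (Hol_topology X Y) \<subseteq> Hol X Y"
    unfolding Hol_topology_def by auto
  \<comment> \<open>For the empty compact set the condition is vacuous, so all of
    \<open>Hol X Y\<close> is a subbasic open set.\<close>
  have "openin (Hol_topology X Y) {f \<in> Hol X Y. f ` {} \<subseteq> points Y}"
    by (rule openin_Hol_topology_subbasis) auto
  then show "Hol X Y \<subseteq> topspace (Hol_topology X Y)"
    using openin_subset by fastforce
qed

text \<open>The property of eventually containing \<open>g\<close> survives finite intersections,
  and for a union one member containing \<open>l\<close> is enough; hence subbasic sets
  suffice.\<close>

lemma limitin_topology_generated_by:
  assumes "l \<in> \<Union>\<S>" and ev: "\<And>S. S \<in> \<S> \<Longrightarrow> l \<in> S \<Longrightarrow> eventually (\<lambda>n. g n \<in> S) F"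
  shows "limitin (topology_generated_by \<S>) g l F"
  unfolding limitin_def
proof safe
  show "l \<in> topspace (topology_generated_by \<S>)" using assms by simp
  fix U assume "openin (topology_generated_by \<S>) U" "l \<in> U"
  then have "generate_topology_on \<S> U" by (simp add: openin_topology_generated_by_iff)
  then have "l \<in> U \<longrightarrow> eventually (\<lambda>n. g n \<in> U) F"
  proof induction
    case (Int a b)
    then show ?case by (auto elim: eventually_elim2)
  next
    case (UN K)
    show ?case
    proof
      assume "l \<in> \<Union>K"
      then obtain k where "k \<in> K" "l \<in> k" by blast
      with UN.IH have "eventually (\<lambda>n. g n \<in> k) F" by blast
      then show "eventually (\<lambda>n. g n \<in> \<Union>K) F"
        by (rule eventually_mono) (use \<open>k \<in> K\<close> in blast)
    qed
  qed (use ev in auto)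
  then show "eventually (\<lambda>n. g n \<in> U) F" using \<open>l \<in> U\<close> by blast
qed

section \<open>Lifting through covering maps\<close>

text \<open>The condition on \<open>T\<close> inside \<open>covering_map\<close>, isolated so that
  it can be passed between lemmas.\<close>

definition evenly_covered :: "'b topology \<Rightarrow> 'a topology \<Rightarrow> ('b \<Rightarrow> 'a) \<Rightarrow> 'a set \<Rightarrow> bool" where
  "evenly_covered Y X p T \<longleftrightarrow> openin X T \<and>
     (\<exists>\<V>. \<Union>\<V> = {y \<in> topspace Y. p y \<in> T} \<and> (\<forall>V\<in>\<V>. openin Y V) \<and> disjoint \<V> \<and>
        (\<forall>V\<in>\<V>. homeomorphic_map (subtopology Y V) (subtopology X T) p))"

lemma covering_map_evenly_covered:
  assumes "covering_map Y X p" "x \<in> topspace X"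
  obtains T where "evenly_covered Y X p T" "x \<in> T"
proof -
  from assms have "\<exists>T. evenly_covered Y X p T \<and> x \<in> T"
    unfolding covering_map_def evenly_covered_def by blast
  then show thesis using that by blast
qed

lemma evenly_covered_openin: "evenly_covered Y X p T \<Longrightarrow> openin X T"
  by (simp add: evenly_covered_def)

lemma evenly_coveredE:
  assumes "evenly_covered Y X p T"
  obtains \<V> where "\<Union>\<V> = {y \<in> topspace Y. p y \<in> T}" "\<forall>V\<in>\<V>. openin Y V" "disjoint \<V>"
    "\<forall>V\<in>\<V>. homeomorphic_map (subtopology Y V) (subtopology X T) p"
  using assms unfolding evenly_covered_def by (elim conjE exE) (rule that)

text \<open>The map \<open>q\<close> is the local inverse of \<open>p\<close> on one sheet. Local
  lifts are compositions with it, and its continuity makes \<open>p\<close> an open map.\<close>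

lemma homeomorphic_sheet_section:
  assumes T: "openin X T" and V: "openin Y V"
    and hom: "homeomorphic_map (subtopology Y V) (subtopology X T) p"
  obtains q where "continuous_map (subtopology X T) Y q"
    "\<forall>x\<in>T. q x \<in> V \<and> p (q x) = x" "\<forall>y\<in>V. q (p y) = y \<and> p y \<in> T"
proof -
  obtain q where q: "homeomorphic_maps (subtopology Y V) (subtopology X T) p q"
    using hom homeomorphic_map_maps by blast
  have tV: "topspace (subtopology Y V) = V" and tT: "topspace (subtopology X T) = T"
    using T V openin_subset by (auto simp: Int_absorb1)
  have cq: "continuous_map (subtopology X T) (subtopology Y V) q"
    and cp: "continuous_map (subtopology Y V) (subtopology X T) p"
    and pq: "\<And>x. x \<in> T \<Longrightarrow> p (q x) = x" and qp: "\<And>y. y \<in> V \<Longrightarrow> q (p y) = y"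
    using q unfolding homeomorphic_maps_def tV tT by auto
  have "\<And>x. x \<in> T \<Longrightarrow> q x \<in> V"
    using continuous_map_funspace[OF cq] unfolding tV tT by auto
  moreover have "\<And>y. y \<in> V \<Longrightarrow> p y \<in> T"
    using continuous_map_funspace[OF cp] unfolding tV tT by auto
  moreover have "continuous_map (subtopology X T) Y q"
    using cq continuous_map_in_subtopology by blast
  ultimately show thesis using that pq qp by blast
qed

lemma evenly_covered_sheet:
  assumes ec: "evenly_covered Y X p T" and y: "y \<in> topspace Y" "p y \<in> T"
  obtains V q where "openin Y V" "y \<in> V" "continuous_map (subtopology X T) Y q"
    "\<forall>x\<in>T. q x \<in> V \<and> p (q x) = x" "\<forall>y\<in>V. q (p y) = y \<and> p y \<in> T"
proof -
  note T = evenly_covered_openin[OF ec]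
  from ec obtain \<V> where \<V>: "\<Union>\<V> = {y \<in> topspace Y. p y \<in> T}" "\<forall>V\<in>\<V>. openin Y V" "disjoint \<V>"
    "\<forall>V\<in>\<V>. homeomorphic_map (subtopology Y V) (subtopology X T) p"
    by (rule evenly_coveredE)
  have "y \<in> \<Union>\<V>" using \<V>(1) y by blast
  then obtain V where V: "V \<in> \<V>" "y \<in> V" by blast
  then have oV: "openin Y V" and hV: "homeomorphic_map (subtopology Y V) (subtopology X T) p"
    using \<V> by auto
  obtain q where q: "continuous_map (subtopology X T) Y q"
    "\<forall>x\<in>T. q x \<in> V \<and> p (q x) = x" "\<forall>y\<in>V. q (p y) = y \<and> p y \<in> T"
    by (rule homeomorphic_sheet_section[OF T oV hV])
  show thesis by (rule that[OF oV V(2) q])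
qed

text \<open>Points of one fibre have neighbourhoods on which values of \<open>p\<close> agree only at equal points,
  or only at distinct points: this is what makes coincidence of two lifts locally constant.\<close>

lemma covering_map_separates:
  assumes cov: "covering_map Y X p" and y: "y1 \<in> topspace Y" "y2 \<in> topspace Y" "p y1 = p y2"
  obtains V1 V2 where "openin Y V1" "openin Y V2" "y1 \<in> V1" "y2 \<in> V2"
    "\<forall>a\<in>V1. \<forall>b\<in>V2. p a = p b \<longrightarrow> (a = b \<longleftrightarrow> y1 = y2)"
proof -
  have "p y1 \<in> topspace X" using cov y by (auto simp: covering_map_def)
  then obtain T where ec: "evenly_covered Y X p T" and T: "p y1 \<in> T"
    by (rule covering_map_evenly_covered[OF cov])
  from ec obtain \<V> where \<V>: "\<Union>\<V> = {y \<in> topspace Y. p y \<in> T}" "\<forall>V\<in>\<V>. openin Y V" "disjoint \<V>"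
    "\<forall>V\<in>\<V>. homeomorphic_map (subtopology Y V) (subtopology X T) p"
    by (rule evenly_coveredE)
  have "y1 \<in> \<Union>\<V>" "y2 \<in> \<Union>\<V>" using \<V>(1) y T by auto
  then obtain V1 V2 where V: "V1 \<in> \<V>" "y1 \<in> V1" "V2 \<in> \<V>" "y2 \<in> V2" by blast
  have inj: "inj_on p V" if "V \<in> \<V>" for V
  proof -
    have "V \<subseteq> topspace Y" using \<V>(2) that openin_subset by blast
    then show ?thesis
      using \<V>(4) that homeomorphic_imp_injective_map[of "subtopology Y V" "subtopology X T" p]
      by (simp add: Int_absorb1)
  qed
  have "a = b \<longleftrightarrow> y1 = y2" if ab: "a \<in> V1" "b \<in> V2" "p a = p b" for a b
  \<comment> \<open>On a common sheet injectivity of \<open>p\<close> gives both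
    \<open>a = b\<close> and \<open>y1 = y2\<close>; on two disjoint sheets both equalities
    fail.\<close>
  proof (cases "V1 = V2")
    case True
    then show ?thesis using inj[OF V(1)] ab V y by (auto dest: inj_onD)
  next
    case False
    then have "V1 \<inter> V2 = {}" using \<V>(3) V by (auto simp: pairwise_def disjnt_def)
    then show ?thesis using ab V by auto
  qed
  then show thesis using that V \<V>(2) by blast
qed

section \<open>Lifts: uniqueness, gluing and existence on convex sets\<close>

definition lift_on :: "'b topology \<Rightarrow> ('b \<Rightarrow> 'a) \<Rightarrow> ('c::topological_space \<Rightarrow> 'a) \<Rightarrow> 'c set \<Rightarrow> ('c \<Rightarrow> 'b) \<Rightarrow> bool"
  where "lift_on Y p h W g \<longleftrightarrow> continuous_map (top_of_set W) Y g \<and> (\<forall>z\<in>W. p (g z) = h z)"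

lemma lift_on_subset: "lift_on Y p h W g \<Longrightarrow> W' \<subseteq> W \<Longrightarrow> lift_on Y p h W' g"
  unfolding lift_on_def
  by (metis continuous_map_from_subtopology inf.absorb_iff2 subset_iff subtopology_subtopology)

lemma lift_on_in_topspace: "lift_on Y p h W g \<Longrightarrow> z \<in> W \<Longrightarrow> g z \<in> topspace Y"
  unfolding lift_on_def using continuous_map_funspace by fastforce

text \<open>By \<open>covering_map_separates\<close>, whether the two lifts agree is constant near
  each point of \<open>W\<close>; connectedness carries agreement from \<open>a\<close> to
  \<open>b\<close>.\<close>

lemma lift_on_unique:
  assumes cov: "covering_map Y X p" and W: "connected W"
    and g1: "lift_on Y p h W g1" and g2: "lift_on Y p h W g2"
    and a: "a \<in> W" "g1 a = g2 a" and b: "b \<in> W"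
  shows "g1 b = g2 b"
proof (rule connected_induction_simple[OF W a(1) b, where P = "\<lambda>z. g1 z = g2 z"])
  show "g1 a = g2 a" by fact
  fix c assume c: "c \<in> W"
  have "p (g1 c) = p (g2 c)" using g1 g2 c by (simp add: lift_on_def)
  then obtain V1 V2 where V: "openin Y V1" "openin Y V2" "g1 c \<in> V1" "g2 c \<in> V2"
    and sep: "\<forall>a\<in>V1. \<forall>b\<in>V2. p a = p b \<longrightarrow> (a = b \<longleftrightarrow> g1 c = g2 c)"
    by (rule covering_map_separates[OF cov lift_on_in_topspace[OF g1 c] lift_on_in_topspace[OF g2 c]])
  have c1: "continuous_map (top_of_set W) Y g1" and c2: "continuous_map (top_of_set W) Y g2"
    using g1 g2 by (auto simp: lift_on_def)
  define N where "N = {z \<in> topspace (top_of_set W). g1 z \<in> V1} \<inter> {z \<in> topspace (top_of_set W). g2 z \<in> V2}"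
  have "openin (top_of_set W) N" unfolding N_def
    by (intro openin_Int openin_continuous_map_preimage[OF c1 V(1)] openin_continuous_map_preimage[OF c2 V(2)])
  moreover have "c \<in> N" using c V by (simp add: N_def)
  moreover have "g1 z = g2 z \<longleftrightarrow> g1 c = g2 c" if "z \<in> N" for z
    using that g1 g2 by (intro sep[rule_format]) (auto simp: N_def lift_on_def)
  ultimately show "\<exists>T. openin (top_of_set W) T \<and> c \<in> T \<and>
      (\<forall>x\<in>T. \<forall>y\<in>T. g1 x = g2 x \<longrightarrow> g1 y = g2 y)"
    by blast
qed

text \<open>With \<open>q\<close> the section of \<open>p\<close> over \<open>T\<close> through
  \<open>a\<close>, the lift is \<open>q \<circ> h\<close>.\<close>

lemma lift_on_local:
  assumes ec: "evenly_covered Y X p T" and h: "continuous_map (top_of_set N) X h"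
    and N: "h ` N \<subseteq> T" "w \<in> N" and a: "a \<in> topspace Y" "p a = h w"
  obtains g where "lift_on Y p h N g" "g w = a"
proof -
  have "p a \<in> T" using a N by auto
  then obtain V q where V: "openin Y V" "a \<in> V" "continuous_map (subtopology X T) Y q"
    "\<forall>x\<in>T. q x \<in> V \<and> p (q x) = x" "\<forall>y\<in>V. q (p y) = y \<and> p y \<in> T"
    by (rule evenly_covered_sheet[OF ec a(1)])
  have "continuous_map (top_of_set N) (subtopology X T) h"
    using h N by (auto simp: continuous_map_in_subtopology)
  then have "continuous_map (top_of_set N) Y (q \<circ> h)"
    using V(3) continuous_map_compose by blast
  moreover have "\<forall>z\<in>N. p ((q \<circ> h) z) = h z" using V(4) N by auto
  moreover have "(q \<circ> h) w = a" using V(2,5) a(2) by (metis comp_apply)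
  ultimately show thesis using that[of "q \<circ> h"] unfolding lift_on_def by blast
qed

lemma lift_on_Union:
  assumes op: "\<And>i. i \<in> I \<Longrightarrow> open (W i)" and g: "\<And>i. i \<in> I \<Longrightarrow> lift_on Y p h (W i) (g i)"
    and agree: "\<And>i j x. i \<in> I \<Longrightarrow> j \<in> I \<Longrightarrow> x \<in> W i \<Longrightarrow> x \<in> W j \<Longrightarrow> g i x = g j x"
  obtains G where "lift_on Y p h (\<Union>i\<in>I. W i) G" "\<And>i x. i \<in> I \<Longrightarrow> x \<in> W i \<Longrightarrow> G x = g i x"
proof -
  let ?U = "\<Union>i\<in>I. W i"
  have sub: "subtopology (top_of_set ?U) (W i) = top_of_set (W i)" if "i \<in> I" for i
  proof -
    have "?U \<inter> W i = W i" using that by blast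
    then show ?thesis by (simp add: subtopology_subtopology)
  qed
  have o: "openin (top_of_set ?U) (W i)" if "i \<in> I" for i
    using op[OF that] that by (intro open_subset) auto
  have c: "continuous_map (subtopology (top_of_set ?U) (W i)) Y (g i)" if "i \<in> I" for i
    using g[OF that] by (simp add: sub[OF that] lift_on_def)
  obtain G where G: "continuous_map (top_of_set ?U) Y G"
    "\<And>x i. i \<in> I \<Longrightarrow> x \<in> topspace (top_of_set ?U) \<inter> W i \<Longrightarrow> G x = g i x"
    using pasting_lemma_exists[where X="top_of_set ?U" and T=W and I=I and f=g and Y=Y] o c agree
    by (metis (no_types, lifting) IntD1 IntD2 order_refl topspace_euclidean_subtopology)
  then have eq: "\<And>i x. i \<in> I \<Longrightarrow> x \<in> W i \<Longrightarrow> G x = g i x" by auto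
  moreover have "lift_on Y p h ?U G"
    using G(1) eq g by (auto simp: lift_on_def)
  ultimately show thesis using that by blast
qed

text \<open>A lift over \<open>N\<close> is started at \<open>g w\<close>. As
  \<open>W \<inter> N\<close> is connected, uniqueness makes it agree with \<open>g\<close> on the
  overlap, and the two are pasted.\<close>

lemma lift_on_extend:
  assumes cov: "covering_map Y X p" and h: "continuous_map (top_of_set N) X h"
    and g: "lift_on Y p h W g" and W: "open W" and N: "open N" "h ` N \<subseteq> T"
    and ec: "evenly_covered Y X p T" and WN: "connected (W \<inter> N)" "w \<in> W" "w \<in> N"
  obtains G where "lift_on Y p h (W \<union> N) G" "\<And>x. x \<in> W \<Longrightarrow> G x = g x"
proof -
  have "p (g w) = h w" using g WN by (simp add: lift_on_def)
  then obtain g' where g': "lift_on Y p h N g'" "g' w = g w"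
    by (rule lift_on_local[OF ec h N(2) WN(3) lift_on_in_topspace[OF g WN(2)]])
  have agree: "g x = g' x" if "x \<in> W" "x \<in> N" for x
    by (rule lift_on_unique[OF cov WN(1) lift_on_subset[OF g] lift_on_subset[OF g'(1)], of w])
      (use that WN g' in auto)
  \<comment> \<open>Booleans index the two open sets so that \<open>lift_on_Union\<close>
    applies.\<close>
  define gg where "gg = (\<lambda>b. if b then g else g')"
  define WW where "WW = (\<lambda>b. if b then W else N)"
  obtain G where "lift_on Y p h (\<Union>b\<in>UNIV. WW b) G" and G: "\<forall>b. \<forall>x\<in>WW b. G x = gg b x"
  proof (rule lift_on_Union[of UNIV WW Y p h gg])
    show "open (WW b)" for b using W N by (simp add: WW_def)
    show "lift_on Y p h (WW b) (gg b)" for b using g g' by (simp add: WW_def gg_def)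
    show "gg b x = gg c x" if "x \<in> WW b" "x \<in> WW c" for b c x
      using that agree by (auto simp: WW_def gg_def split: if_splits)
  qed blast
  moreover have "(\<Union>b\<in>UNIV. WW b) = W \<union> N" by (auto simp: WW_def split: if_splits)
  moreover have "G x = g x" if "x \<in> W" for x
    using G[rule_format, of x True] that by (simp add: WW_def gg_def)
  ultimately show thesis using that by metis
qed

text \<open>Along the segment the lift is extended over one small ball after another; the neighbourhoods
  are kept convex so that lifts along different segments agree on overlaps.\<close>

lemma lift_on_near_segment:
  fixes S :: "'c::euclidean_space set"
  assumes cov: "covering_map Y X p" and S: "open S" "convex S" "0 \<in> S"
    and h: "continuous_map (top_of_set S) X h" and a: "a \<in> topspace Y" "p a = h 0" and z: "z \<in> S"
  shows "\<exists>W g. open W \<and> convex W \<and> 0 \<in> W \<and> z \<in> W \<and> W \<subseteq> S \<and> lift_on Y p h W g \<and> g 0 = a"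
proof -
  define \<G> where "\<G> = {G. open G \<and> G \<subseteq> S \<and> (\<exists>T. evenly_covered Y X p T \<and> h ` G \<subseteq> T)}"
  have LS: "closed_segment 0 z \<subseteq> S" using S z by (simp add: closed_segment_subset)
  have cover: "closed_segment 0 z \<subseteq> \<Union>\<G>"
  proof
    fix x assume "x \<in> closed_segment 0 z"
    then have x: "x \<in> S" using LS by blast
    then have "h x \<in> topspace X" using continuous_map_funspace[OF h] by auto
    then obtain T where T: "evenly_covered Y X p T" "h x \<in> T"
      by (rule covering_map_evenly_covered[OF cov])
    define G where "G = {y \<in> topspace (top_of_set S). h y \<in> T}"
    have "openin (top_of_set S) G" unfolding G_def
      by (rule openin_continuous_map_preimage[OF h evenly_covered_openin[OF T(1)]])
    then have "open G" using S openin_open_trans by blast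
    then have "G \<in> \<G>" using T by (auto simp: \<G>_def G_def)
    moreover have "x \<in> G" using x T by (simp add: G_def)
    ultimately show "x \<in> \<Union>\<G>" by blast
  qed
  \<comment> \<open>A Lebesgue number of the cover: \<open>h\<close> maps every ball of this radius
    about a point of the segment into an evenly covered set.\<close>
  obtain \<epsilon> where \<epsilon>: "0 < \<epsilon>" "\<forall>x\<in>closed_segment 0 z. \<exists>G\<in>\<G>. ball x \<epsilon> \<subseteq> G"
  proof (rule Heine_Borel_lemma[OF compact_segment cover])
    show "open G" if "G \<in> \<G>" for G using that by (simp add: \<G>_def)
  qed blast
  define \<delta> where "\<delta> = \<epsilon> / 2"
  have \<delta>: "0 < \<delta>" using \<epsilon> by (simp add: \<delta>_def)
  obtain n :: nat where "norm z / \<delta> < n" using reals_Archimedean2 by blast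
  then have "norm z < n * \<delta>" using \<delta> by (simp add: pos_divide_less_eq)
  moreover from this have "n > 0" by (auto intro!: Nat.gr0I simp: not_less[symmetric])
  ultimately have n: "n > 0" "norm z / n < \<delta>" by (auto simp: pos_divide_less_eq mult.commute)
  \<comment> \<open>\<open>P t\<close> is the part of the segment up to
    \<open>t *\<^sub>R z\<close>, and \<open>W t\<close> is its \<delta>-neighbourhood. As the sum
    of a convex set and an open ball, it is open and convex.\<close>
  define P where "P t = (\<lambda>s. s *\<^sub>R z) ` {0..t}" for t :: real
  define W where "W t = (\<Union>x\<in>P t. \<Union>y\<in>ball 0 \<delta>. {x + y})" for t
  have oW: "open (W t)" for t unfolding W_def by (intro open_sums) simp
  have cW: "convex (W t)" for t
  proof -
    have "linear (\<lambda>s. s *\<^sub>R z)" by (simp add: linearI scaleR_add_left)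
    then have "convex (P t)" unfolding P_def by (intro convex_linear_image) auto
    then show ?thesis unfolding W_def by (intro convex_sums) auto
  qed
  have WI: "s *\<^sub>R z + y \<in> W t" if "0 \<le> s" "s \<le> t" "norm y < \<delta>" for s t y
    unfolding W_def P_def using that by (intro UN_I[of "s *\<^sub>R z"] UN_I[of y]) auto
  have PW: "s *\<^sub>R z \<in> W t" if "0 \<le> s" "s \<le> t" for s t
    using WI[OF that, of 0] \<delta> by simp
  have seg: "s *\<^sub>R z \<in> closed_segment 0 z" if "0 \<le> s" "s \<le> 1" for s
    using that by (auto simp: in_segment)
  have nbhd: "\<exists>G\<in>\<G>. ball (s *\<^sub>R z) \<epsilon> \<subseteq> G" if "0 \<le> s" "s \<le> 1" for s
    using \<epsilon>(2) seg[OF that] by blast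
  have "k \<le> n \<Longrightarrow> \<exists>g. lift_on Y p h (W (k / n)) g \<and> g 0 = a" for k
  proof (induction k)
    case 0
    obtain G T where G: "G \<in> \<G>" "ball 0 \<epsilon> \<subseteq> G" "evenly_covered Y X p T" "h ` G \<subseteq> T"
      using nbhd[of 0] by (auto simp: \<G>_def)
    have W0: "W 0 = ball 0 \<delta>" by (auto simp: W_def P_def)
    have sub: "ball 0 \<delta> \<subseteq> G" using G(2) \<epsilon>(1) by (auto simp: \<delta>_def)
    have "continuous_map (top_of_set (ball 0 \<delta>)) X h"
      using h sub G(1) by (auto simp: \<G>_def intro: continuous_map_from_subtopology_mono)
    moreover have "h ` ball 0 \<delta> \<subseteq> T" using sub G(4) by (meson image_mono order_trans)
    moreover have "0 \<in> ball 0 \<delta>" using \<delta> by simp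
    ultimately obtain g where "lift_on Y p h (ball 0 \<delta>) g" "g 0 = a"
      using lift_on_local[OF G(3), where N="ball 0 \<delta>" and w=0 and h=h and a=a] a by metis
    then show ?case using W0 by auto
  next
    case (Suc k)
    then obtain g where g: "lift_on Y p h (W (k / n)) g" "g 0 = a" by auto
    define c where "c = (k / n) *\<^sub>R z"
    have k: "0 \<le> k / n" "k / n \<le> 1" using Suc.prems by auto
    obtain G T where G: "G \<in> \<G>" "ball c \<epsilon> \<subseteq> G" "evenly_covered Y X p T" "h ` G \<subseteq> T"
      using nbhd[OF k] by (auto simp: \<G>_def c_def)
    have hN: "continuous_map (top_of_set (ball c \<epsilon>)) X h"
      using h G(1,2) by (auto simp: \<G>_def intro: continuous_map_from_subtopology_mono)
    have "connected (W (k / n) \<inter> ball c \<epsilon>)"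
      by (intro convex_connected convex_Int cW) simp
    moreover have "c \<in> W (k / n)" using PW[of "k/n" "k/n"] k by (simp add: c_def)
    moreover have "h ` ball c \<epsilon> \<subseteq> T" using G by blast
    ultimately obtain g' where g': "lift_on Y p h (W (k / n) \<union> ball c \<epsilon>) g'"
      and eq: "\<forall>x\<in>W (k / n). g' x = g x"
      using lift_on_extend[OF cov hN g(1) oW open_ball _ G(3), of c] \<epsilon>(1) by (metis centre_in_ball)
    \<comment> \<open>A point of the longer neighbourhood outside \<open>W (k / n)\<close> has
      distance less than \<open>norm z / n + \<delta> < \<epsilon>\<close> from \<open>c\<close>, so
      a single ball covers what is new.\<close>
    have "W (Suc k / n) \<subseteq> W (k / n) \<union> ball c \<epsilon>"
    proof
      fix w assume "w \<in> W (Suc k / n)"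
      then obtain s y where s: "0 \<le> s" "s \<le> Suc k / n" "norm y < \<delta>" "w = s *\<^sub>R z + y"
        by (auto simp: W_def P_def)
      show "w \<in> W (k / n) \<union> ball c \<epsilon>"
      proof (cases "s \<le> k / n")
        case True
        then have "w \<in> W (k / n)" using s WI by simp
        then show ?thesis by blast
      next
        case False
        then have s': "\<bar>s - k / n\<bar> \<le> 1 / n" using s by (simp add: add_divide_distrib)
        have "w - c = (s - k / n) *\<^sub>R z + y" by (simp add: s c_def scaleR_diff_left)
        then have "norm (w - c) \<le> \<bar>s - k / n\<bar> * norm z + norm y"
          by (metis norm_scaleR norm_triangle_ineq)
        also have "\<dots> \<le> 1 / n * norm z + norm y"
          by (intro add_right_mono mult_right_mono s') simp
        also have "1 / n * norm z = norm z / n" by simp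
        also have "norm z / n + norm y < \<epsilon>" using n(2) s(3) \<delta>_def by linarith
        finally show ?thesis by (simp add: dist_norm norm_minus_commute)
      qed
    qed
    then have "lift_on Y p h (W (Suc k / n)) g'" using g' lift_on_subset by blast
    moreover have "g' 0 = a" using eq g(2) PW[of 0 "k/n"] k by simp
    ultimately show ?case by blast
  qed
  from this[of n] obtain g where g: "lift_on Y p h (W 1) g" "g 0 = a" using n(1) by auto
  have "W 1 \<subseteq> S"
  proof
    fix w assume "w \<in> W 1"
    then obtain s y where s: "0 \<le> s" "s \<le> 1" "norm y < \<delta>" "w = s *\<^sub>R z + y"
      by (auto simp: W_def P_def)
    then have "w \<in> ball (s *\<^sub>R z) \<epsilon>" using \<delta> by (simp add: \<delta>_def dist_norm)
    then show "w \<in> S" using nbhd[OF s(1,2)] by (auto simp: \<G>_def)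
  qed
  moreover have "0 \<in> W 1" "z \<in> W 1" using PW[of 0 1] PW[of 1 1] by auto
  ultimately show ?thesis using g oW cW by blast
qed

text \<open>Lifts along different segments have convex domains containing 0 and the common value
  \<open>a\<close> there. By uniqueness they agree on overlaps and glue to a lift on
  \<open>S\<close>.\<close>

lemma covering_map_lift_convex:
  fixes S :: "'c::euclidean_space set"
  assumes cov: "covering_map Y X p" and S: "open S" "convex S" "0 \<in> S"
    and h: "continuous_map (top_of_set S) X h" and a: "a \<in> topspace Y" "p a = h 0"
  shows "\<exists>g. lift_on Y p h S g \<and> g 0 = a"
proof -
  have "\<forall>z\<in>S. \<exists>W g. open W \<and> convex W \<and> 0 \<in> W \<and> z \<in> W \<and> W \<subseteq> S \<and> lift_on Y p h W g \<and> g 0 = a"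
    using lift_on_near_segment[OF cov S h a] by blast
  then obtain W g where Wg: "\<forall>z\<in>S. open (W z) \<and> convex (W z) \<and> 0 \<in> W z \<and> z \<in> W z \<and> W z \<subseteq> S \<and>
      lift_on Y p h (W z) (g z) \<and> g z 0 = a"
    by metis
  have agree: "g i x = g j x" if "i \<in> S" "j \<in> S" "x \<in> W i" "x \<in> W j" for i j x
  proof (rule lift_on_unique[OF cov, of "W i \<inter> W j" h "g i" "g j" 0])
    show "connected (W i \<inter> W j)" using that Wg by (intro convex_connected convex_Int) auto
    show "lift_on Y p h (W i \<inter> W j) (g i)" "lift_on Y p h (W i \<inter> W j) (g j)"
      using that Wg by (auto intro: lift_on_subset)
  qed (use that Wg in auto)
  obtain G where "lift_on Y p h (\<Union>z\<in>S. W z) G" "\<forall>z\<in>S. \<forall>x\<in>W z. G x = g z x"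
  proof (rule lift_on_Union[of S W Y p h g])
    show "g i x = g j x" if "i \<in> S" "j \<in> S" "x \<in> W i" "x \<in> W j" for i j x
      using agree that .
  qed (use Wg in auto)
  moreover have "(\<Union>z\<in>S. W z) = S" using Wg by blast
  ultimately show ?thesis using Wg S(3) by auto
qed

section \<open>Lifts to the unit disk\<close>

text \<open>For a local section \<open>q\<close> through a point \<open>y\<close> of
  \<open>S\<close>, the set of all \<open>x\<close> with \<open>q x \<in> S\<close> is an open
  neighbourhood of \<open>p y\<close> inside the image of \<open>S\<close>.\<close>

lemma covering_map_open_map:
  assumes cov: "covering_map Y X p"
  shows "open_map Y X p"
  unfolding open_map_def
proof safe
  fix S assume S: "openin Y S"
  show "openin X (p ` S)"
  proof (subst openin_subopen, safe)
    fix y assume y: "y \<in> S"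
    then have yY: "y \<in> topspace Y" using S openin_subset by blast
    then have "p y \<in> topspace X" using cov by (auto simp: covering_map_def)
    then obtain T where ec: "evenly_covered Y X p T" and T: "p y \<in> T"
      by (rule covering_map_evenly_covered[OF cov])
    obtain V q where V: "openin Y V" "y \<in> V" "continuous_map (subtopology X T) Y q"
      "\<forall>x\<in>T. q x \<in> V \<and> p (q x) = x" "\<forall>y\<in>V. q (p y) = y \<and> p y \<in> T"
      by (rule evenly_covered_sheet[OF ec yY T])
    define N where "N = {x \<in> topspace (subtopology X T). q x \<in> S}"
    have "openin (subtopology X T) N" unfolding N_def
      by (rule openin_continuous_map_preimage[OF V(3) S])
    then have "openin X N"
      using openin_trans_full evenly_covered_openin[OF ec] by blast
    moreover have "p y \<in> N"
      using V(2,5) y T evenly_covered_openin[OF ec] by (auto simp: N_def dest: openin_subset)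
    moreover have "N \<subseteq> p ` S"
    proof
      fix x assume "x \<in> N"
      then have "q x \<in> S" "p (q x) = x" using V(4) by (auto simp: N_def)
      then show "x \<in> p ` S" by (metis imageI)
    qed
    ultimately show "\<exists>T. openin X T \<and> p y \<in> T \<and> T \<subseteq> p ` S" by blast
  qed
qed

section \<open>Holomorphic lifts of self-maps\<close>

lemma topo_unit_disk: "topo unit_disk = top_of_set (ball 0 1)"
  by (simp add: unit_disk_def)

lemma holomorphic_map_unit_diskD:
  assumes "holomorphic_map unit_disk X f" "(V, \<psi>) \<in> atlas X"
  shows "(\<psi> \<circ> f) holomorphic_on ball 0 1 \<inter> f -` V"
proof -
  have "(ball 0 1, id) \<in> atlas unit_disk" by (simp add: unit_disk_def)
  from holomorphic_mapD[OF assms(1) this assms(2)]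
  have "(\<psi> \<circ> f \<circ> inv_into (ball 0 1) id) holomorphic_on ball 0 1 \<inter> f -` V" by simp
  then show ?thesis
    by (rule holomorphic_transform) (metis IntD1 comp_apply id_apply inj_on_id inv_into_f_f)
qed

text \<open>On a small piece of a sheet \<open>\<psi> \<circ> p\<close> is injective and has a
  holomorphic inverse \<open>k\<close>. Continuity keeps \<open>g\<close> in that piece near
  \<open>z0\<close>, so there \<open>g = k \<circ> (\<psi> \<circ> h)\<close>.\<close>

lemma lift_on_unit_disk_holomorphic:
  assumes X: "riemann_surface X" and cov: "covering_map (topo unit_disk) (topo X) p"
    and p: "holomorphic_map unit_disk X p" and h: "holomorphic_map unit_disk X h"
    and g: "lift_on (topo unit_disk) p h (ball 0 1) g"
  shows "g holomorphic_on ball 0 1"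
proof (rule holomorphic_on_local)
  fix z0 :: complex assume z0: "z0 \<in> ball 0 1"
  have cg: "continuous_map (top_of_set (ball 0 1)) (topo unit_disk) g"
    and pg: "\<And>z. z \<in> ball 0 1 \<Longrightarrow> p (g z) = h z"
    using g by (auto simp: lift_on_def)
  have gz0: "g z0 \<in> topspace (topo unit_disk)" by (rule lift_on_in_topspace[OF g z0])
  have cp: "continuous_map (topo unit_disk) (topo X) p" using p by (simp add: holomorphic_map_def)
  have px: "p (g z0) \<in> points X" using gz0 continuous_map_funspace[OF cp] by auto
  obtain V \<psi> where V: "(V, \<psi>) \<in> atlas X" "p (g z0) \<in> V"
    by (rule riemann_surface_chart_exists[OF X px])
  have cV: "chart_on (topo X) (V, \<psi>)" by (rule riemann_surface_chart[OF X V(1)])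
  obtain T where ec: "evenly_covered (topo unit_disk) (topo X) p T" and T: "p (g z0) \<in> T"
    by (rule covering_map_evenly_covered[OF cov px])
  obtain S q where S: "openin (topo unit_disk) S" "g z0 \<in> S" "continuous_map (subtopology (topo X) T) (topo unit_disk) q"
    "\<forall>x\<in>T. q x \<in> S \<and> p (q x) = x" "\<forall>y\<in>S. q (p y) = y \<and> p y \<in> T"
    by (rule evenly_covered_sheet[OF ec gz0 T])
  define R where "R = S \<inter> {y \<in> topspace (topo unit_disk). p y \<in> V}"
  have oR: "openin (topo unit_disk) R" unfolding R_def
    by (intro openin_Int S(1) openin_continuous_map_preimage[OF cp] chart_on_openin[OF cV])
  have RD: "R \<subseteq> ball 0 1" using openin_subset[OF oR] by (simp add: topo_unit_disk)
  have "open R" using oR unfolding topo_unit_disk by (meson open_ball openin_open_trans)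
  have hR: "(\<psi> \<circ> p) holomorphic_on R"
    by (rule holomorphic_on_subset[OF holomorphic_map_unit_diskD[OF p V(1)]]) (use RD in \<open>auto simp: R_def\<close>)
  have injR: "inj_on (\<psi> \<circ> p) R"
  proof (rule inj_onI)
    fix a b assume ab: "a \<in> R" "b \<in> R" "(\<psi> \<circ> p) a = (\<psi> \<circ> p) b"
    then have "p a = p b" using chart_on_inj[OF cV] by (auto simp: R_def dest: inj_onD)
    then show "a = b" using ab S(5) by (metis IntD1 R_def)
  qed
  obtain k where k: "k holomorphic_on ((\<psi> \<circ> p) ` R)" "\<And>z. z \<in> R \<Longrightarrow> k ((\<psi> \<circ> p) z) = z"
    by (rule holomorphic_has_inverse[OF hR \<open>open R\<close> injR]) blast
  define M where "M = {z \<in> topspace (top_of_set (ball 0 1)). g z \<in> R}"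
  have oM: "openin (top_of_set (ball 0 1)) M" unfolding M_def
    by (rule openin_continuous_map_preimage[OF cg oR])
  then have "open M" by (meson open_ball openin_open_trans)
  have "(k \<circ> (\<psi> \<circ> h)) holomorphic_on M"
  proof (rule holomorphic_on_compose_gen[OF _ k(1)])
    show "(\<psi> \<circ> h) holomorphic_on M"
      by (rule holomorphic_on_subset[OF holomorphic_map_unit_diskD[OF h V(1)]])
        (auto simp: M_def R_def pg[symmetric])
    show "(\<psi> \<circ> h) ` M \<subseteq> (\<psi> \<circ> p) ` R"
      by (force simp: M_def pg[symmetric])
  qed
  then have "g holomorphic_on M"
  proof (rule holomorphic_transform)
    fix z assume "z \<in> M"
    then show "(k \<circ> (\<psi> \<circ> h)) z = g z"
      using k(2)[of "g z"] by (simp add: M_def pg)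
  qed
  moreover have "z0 \<in> M" using z0 gz0 S(2) V(2) by (simp add: M_def R_def)
  ultimately show "\<exists>B. open B \<and> z0 \<in> B \<and> g holomorphic_on B" using \<open>open M\<close> by blast
qed

text \<open>The disk is convex, so \<open>f \<circ> p\<close> lifts through \<open>p\<close>. The
  value at 0 may be any point over \<open>f (p 0)\<close>, a freedom that
  \<open>Hol_locally_bounded\<close> exploits.\<close>

lemma Hol_lift_unit_disk:
  assumes X: "riemann_surface X" and p: "universal_covering unit_disk X p"
    and f: "f \<in> Hol X X" and a: "a \<in> ball 0 1" "p a = f (p 0)"
  obtains g where "g holomorphic_on ball 0 1" "g ` ball 0 1 \<subseteq> ball 0 1"
    "\<forall>z\<in>ball 0 1. p (g z) = f (p z)" "g 0 = a"
proof -
  have D: "riemann_surface unit_disk" and cov: "covering_map (topo unit_disk) (topo X) p"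
    and hp: "holomorphic_map unit_disk X p"
    using p by (auto simp: universal_covering_def)
  have hh: "holomorphic_map unit_disk X (f \<circ> p)"
    using f riemann_surface_fst_chart_openin[OF X]
    by (intro holomorphic_map_compose[OF D X hp]) (auto simp: Hol_def)
  then have "continuous_map (top_of_set (ball 0 1)) (topo X) (f \<circ> p)"
    by (simp add: holomorphic_map_def topo_unit_disk)
  then obtain g where g: "lift_on (topo unit_disk) p (f \<circ> p) (ball 0 1) g" "g 0 = a"
    using covering_map_lift_convex[OF cov, of "ball 0 1" "f \<circ> p" a] a
    by (auto simp: topo_unit_disk)
  have "g holomorphic_on ball 0 1"
    by (rule lift_on_unit_disk_holomorphic[OF X cov hp hh g(1)])
  moreover have "g ` ball 0 1 \<subseteq> ball 0 1"
    using lift_on_in_topspace[OF g(1)] by (auto simp: topo_unit_disk)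
  moreover have "\<forall>z\<in>ball 0 1. p (g z) = f (p z)" using g(1) by (simp add: lift_on_def)
  ultimately show thesis using that g(2) by blast
qed

text \<open>For a lift \<open>g\<close> of \<open>f\<close>, the image of \<open>S\<close> under
  \<open>f\<close> is obtained from the preimage of \<open>S\<close> under \<open>p\<close> by
  applying \<open>g\<close> and then \<open>p\<close>. Since \<open>p\<close> is onto and
  \<open>f\<close> is not constant, neither is \<open>g\<close>; the open mapping theorem applies to
  \<open>g\<close>, and \<open>p\<close> is open.\<close>

lemma Hol_open_map:
  assumes X: "riemann_surface X" and p: "universal_covering unit_disk X p"
    and f: "f \<in> Hol X X" and nc: "\<And>c. \<exists>x\<in>points X. f x \<noteq> c"
  shows "open_map (topo X) (topo X) f"
  unfolding open_map_def
proof safe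
  fix S assume S: "openin (topo X) S"
  have cov: "covering_map (topo unit_disk) (topo X) p"
    using p by (auto simp: universal_covering_def)
  have cp: "continuous_map (topo unit_disk) (topo X) p" and onto: "p ` ball 0 1 = points X"
    using cov by (auto simp: covering_map_def topo_unit_disk)
  have "f (p 0) \<in> p ` ball 0 1"
    using Hol_in_points[OF f] onto by (metis centre_in_ball imageI zero_less_one)
  then obtain a where a: "a \<in> ball 0 1" "p a = f (p 0)" by auto
  obtain g where g: "g holomorphic_on ball 0 1" "g ` ball 0 1 \<subseteq> ball 0 1"
    "\<forall>z\<in>ball 0 1. p (g z) = f (p z)" "g 0 = a"
    by (rule Hol_lift_unit_disk[OF X p f a])
  have gnc: "\<not> g constant_on ball 0 1"
  proof
    assume "g constant_on ball 0 1"
    then obtain b where b: "\<forall>z\<in>ball 0 1. g z = b" by (auto simp: constant_on_def)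
    obtain x where x: "x \<in> points X" "f x \<noteq> p b" using nc by blast
    then obtain z where "z \<in> ball 0 1" "x = p z" using onto by blast
    then show False using x b g(3) by auto
  qed
  define R where "R = {z \<in> topspace (topo unit_disk). p z \<in> S}"
  have oR: "openin (topo unit_disk) R" unfolding R_def
    by (rule openin_continuous_map_preimage[OF cp S])
  then have "open R" unfolding topo_unit_disk by (meson open_ball openin_open_trans)
  moreover have RD: "R \<subseteq> ball 0 1" by (auto simp: R_def topo_unit_disk)
  ultimately have "open (g ` R)"
    by (intro open_mapping_thm[OF g(1) _ _ _ _ gnc]) auto
  then have "openin (topo unit_disk) (g ` R)"
    using RD g(2) unfolding topo_unit_disk by (intro open_subset) auto
  then have "openin (topo X) (p ` g ` R)"
    using covering_map_open_map[OF cov] by (simp add: open_map_def)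
  moreover have "p ` g ` R = f ` S"
  proof -
    have "S \<subseteq> p ` ball 0 1" using openin_subset[OF S] onto by simp
    then have "p ` R = S" by (auto simp: R_def topo_unit_disk)
    moreover have "p ` g ` R = f ` p ` R" using g(3) RD by (force simp: image_image)
    ultimately show ?thesis by simp
  qed
  ultimately show "openin (topo X) (f ` S)" by simp
qed

text \<open>A Moebius map taking \<open>g 0\<close> to 0 reduces the claim to the Schwarz lemma,
  which puts the image of \<open>g z\<close> into the disk of radius \<open>r\<close>. Undoing the
  Moebius map leaves \<open>g z\<close> in a compact subset of the disk depending only on
  \<open>s\<close> and \<open>r\<close>.\<close>

lemma Schwarz_Pick_compact:
  assumes s: "0 \<le> s" "s < 1" and r: "0 \<le> r" "r < 1"
  obtains R where "0 \<le> R" "R < 1"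
    "\<forall>g z. g holomorphic_on ball 0 1 \<longrightarrow> g ` ball 0 1 \<subseteq> ball 0 1 \<longrightarrow> norm (g 0) \<le> s \<longrightarrow>
       norm z \<le> r \<longrightarrow> norm (g z) \<le> R"
proof -
  \<comment> \<open>For fixed \<open>w\<close> this is the inverse of
    \<open>Moebius_function 0 w\<close>; it sends 0 to \<open>w\<close>.\<close>
  define m where "m = (\<lambda>(w, u). Moebius_function 0 (- w) u)"
  define C where "C = m ` (cball 0 s \<times> cball 0 r)"
  have "continuous_on (cball 0 s \<times> cball 0 r) (\<lambda>x. (snd x - - fst x) / (1 - cnj (- fst x) * snd x))"
  proof (intro continuous_intros ballI)
    fix x :: "complex \<times> complex" assume "x \<in> cball 0 s \<times> cball 0 r"
    then have "norm (fst x) \<le> s" "norm (snd x) \<le> r" by (auto simp: mem_Times_iff)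
    then have "norm (cnj (- fst x) * snd x) \<le> s * r"
      unfolding norm_mult using s r by (intro mult_mono) auto
    also have "\<dots> < 1" using s r by (smt (verit) mult_left_le)
    finally show "1 - cnj (- fst x) * snd x \<noteq> 0" by (metis less_irrefl norm_one right_minus_eq)
  qed
  then have "continuous_on (cball 0 s \<times> cball 0 r) m"
    by (rule continuous_on_eq) (auto simp: m_def Moebius_function_simple)
  then have "compact C" unfolding C_def
    by (intro compact_continuous_image compact_Times) auto
  moreover have "C \<noteq> {}" using s r by (auto simp: C_def)
  \<comment> \<open>The bound is the largest norm on \<open>C\<close>; being attained in
    \<open>C\<close>, it is below 1.\<close>
  ultimately obtain c where c: "c \<in> C" "\<forall>x\<in>C. norm x \<le> norm c"
    using continuous_attains_sup[of C norm] by (auto intro: continuous_intros)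
  have "norm c < 1" using c(1) s r
    by (auto simp: C_def m_def intro!: Moebius_function_norm_lt_1)
  moreover have "norm (g z) \<le> norm c"
    if g: "g holomorphic_on ball 0 1" "g ` ball 0 1 \<subseteq> ball 0 1" "norm (g 0) \<le> s" and z: "norm z \<le> r" for g z
  proof -
    define w where "w = g 0"
    have w: "norm w \<le> s" "norm w < 1" using g s by (auto simp: w_def)
    have z1: "norm z < 1" using z r by simp
    have gD: "norm (g x) < 1" if "norm x < 1" for x using g(2) that by (auto simp: image_subset_iff)
    define u where "u = Moebius_function 0 w (g z)"
    have "norm ((Moebius_function 0 w \<circ> g) z) \<le> norm z"
    proof (rule Schwarz_Lemma)
      show "(Moebius_function 0 w \<circ> g) holomorphic_on ball 0 1"
        by (rule holomorphic_on_compose_gen[OF g(1) Moebius_function_holomorphic[OF w(2)] g(2)])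
      show "(Moebius_function 0 w \<circ> g) 0 = 0" by (simp add: w_def Moebius_function_eq_zero)
      show "norm ((Moebius_function 0 w \<circ> g) x) < 1" if "norm x < 1" for x
        using gD[OF that] w by (simp add: Moebius_function_norm_lt_1)
    qed (rule z1)
    then have "norm u \<le> r" using z by (simp add: u_def)
    then have "m (w, u) \<in> C" using w by (auto simp: C_def)
    moreover have "m (w, u) = g z"
      using w gD[OF z1] by (simp add: m_def u_def Moebius_function_compose)
    ultimately show ?thesis using c(2) by metis
  qed
  ultimately show thesis using that[of "norm c"] by auto
qed

section \<open>Perturbing the iterates\<close>

text \<open>The neighbourhood constrains \<open>f\<close> only at the point \<open>p 0\<close>. Each
  such \<open>f\<close> has a lift with \<open>norm (g 0) < s\<close>, and Schwarz-Pick bounds all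
  these lifts at once on every smaller disk.\<close>

lemma Hol_locally_bounded:
  assumes X: "riemann_surface X" and p: "universal_covering unit_disk X p" and F: "F \<in> Hol X X"
  obtains N where "openin (Hol_topology X X) N" "F \<in> N"
    "\<forall>r. 0 \<le> r \<and> r < 1 \<longrightarrow> (\<exists>R. 0 \<le> R \<and> R < 1 \<and> (\<forall>f\<in>N. f ` p ` cball 0 r \<subseteq> p ` cball 0 R))"
proof -
  have cov: "covering_map (topo unit_disk) (topo X) p"
    using p by (auto simp: universal_covering_def)
  have onto: "p ` ball 0 1 = points X"
    using cov by (auto simp: covering_map_def topo_unit_disk)
  have p0: "p 0 \<in> points X" using onto by (metis centre_in_ball imageI zero_less_one)
  then have "F (p 0) \<in> p ` ball 0 1" using Hol_in_points[OF F] onto by simp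
  then obtain b where b: "norm b < 1" "F (p 0) = p b" by auto
  \<comment> \<open>Strictly above \<open>norm b\<close>, so that \<open>F\<close> satisfies the
    condition defining \<open>N\<close>, and still below 1.\<close>
  define s where "s = (1 + norm b) / 2"
  have s: "0 \<le> s" "s < 1" "norm b < s" using b by (auto simp: s_def)
  define N where "N = {f \<in> Hol X X. f ` {p 0} \<subseteq> p ` ball 0 s}"
  have "openin (topo unit_disk) (ball 0 s)" unfolding topo_unit_disk using s by (intro open_subset) auto
  then have "openin (topo X) (p ` ball 0 s)"
    using covering_map_open_map[OF cov] by (simp add: open_map_def)
  then have "openin (Hol_topology X X) N"
    unfolding N_def using p0 by (intro openin_Hol_topology_subbasis) auto
  moreover have "F \<in> N" using F b s by (auto simp: N_def)
  moreover have "\<exists>R. 0 \<le> R \<and> R < 1 \<and> (\<forall>f\<in>N. f ` p ` cball 0 r \<subseteq> p ` cball 0 R)"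
    if r: "0 \<le> r" "r < 1" for r
  proof -
    obtain R where R: "0 \<le> R" "R < 1"
      "\<forall>g z. g holomorphic_on ball 0 1 \<longrightarrow> g ` ball 0 1 \<subseteq> ball 0 1 \<longrightarrow> norm (g 0) \<le> s \<longrightarrow>
       norm z \<le> r \<longrightarrow> norm (g z) \<le> R"
      by (rule Schwarz_Pick_compact[OF s(1,2) r])
    have "f (p z) \<in> p ` cball 0 R" if f: "f \<in> N" and z: "norm z \<le> r" for f z
    proof -
      obtain a where a: "norm a < s" "p a = f (p 0)" using f by (auto simp: N_def)
      then have a1: "a \<in> ball 0 1" using s by simp
      have fH: "f \<in> Hol X X" using f by (simp add: N_def)
      obtain g where g: "g holomorphic_on ball 0 1" "g ` ball 0 1 \<subseteq> ball 0 1"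
        "\<forall>z\<in>ball 0 1. p (g z) = f (p z)" "g 0 = a"
        by (rule Hol_lift_unit_disk[OF X p fH a1 a(2)])
      have "norm (g z) \<le> R" using R(3) g z a by auto
      moreover have "f (p z) = p (g z)" using g(3) z r by simp
      ultimately show ?thesis by simp
    qed
    then show ?thesis using R(1,2) by (intro exI[of _ R]) auto
  qed
  ultimately show thesis using that by blast
qed

text \<open>The images of the smaller open disks are open and cover the space. Finitely many of them
  cover \<open>K\<close>, and the largest radius serves.\<close>

lemma compactin_subset_image_cball:
  assumes cov: "covering_map (topo unit_disk) T p" and K: "compactin T K"
  obtains r where "0 \<le> r" "r < 1" "K \<subseteq> p ` cball 0 r"
proof -
  define \<B> where "\<B> = (\<lambda>r. p ` ball 0 r) ` {0<..<1}"
  have "openin T U" if U: "U \<in> \<B>" for U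
  proof -
    obtain r where r: "r < 1" "U = p ` ball 0 r" using U by (auto simp: \<B>_def)
    then have "openin (topo unit_disk) (ball 0 r)"
      unfolding topo_unit_disk by (intro open_subset) auto
    then show ?thesis using r covering_map_open_map[OF cov] by (simp add: open_map_def)
  qed
  moreover have "K \<subseteq> \<Union>\<B>"
  proof
    fix x assume "x \<in> K"
    then have "x \<in> p ` ball 0 1"
      using compactin_subset_topspace[OF K] cov by (auto simp: covering_map_def topo_unit_disk)
    then obtain z where z: "norm z < 1" "x = p z" by auto
    then have "x \<in> p ` ball 0 ((1 + norm z) / 2)" by auto
    moreover have "(1 + norm z) / 2 \<in> {0<..<1}" using z by (simp add: add_pos_nonneg)
    ultimately show "x \<in> \<Union>\<B>" unfolding \<B>_def by blast
  qed
  ultimately obtain \<F> where \<F>: "finite \<F>" "\<F> \<subseteq> \<B>" "K \<subseteq> \<Union>\<F>"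
    using K unfolding compactin_def by metis
  then obtain C where C: "finite C" "C \<subseteq> {0<..<1}" "\<F> = (\<lambda>r. p ` ball 0 r) ` C"
    unfolding \<B>_def by (meson finite_subset_image)
  \<comment> \<open>Inserting 0 makes the maximum meaningful, and the radius nonnegative, even if no
    disk was selected.\<close>
  define r where "r = Max (insert 0 C)"
  have "0 \<le> r" using C(1) by (simp add: r_def)
  moreover have "r < 1" using C by (auto simp: r_def)
  moreover have "K \<subseteq> p ` cball 0 r"
  proof
    fix x assume "x \<in> K"
    then obtain u z where "u \<in> C" "norm z < u" "x = p z" using \<F>(3) C(3) by auto
    moreover from this have "u \<le> r" using C(1) by (simp add: r_def)
    ultimately show "x \<in> p ` cball 0 r" by auto
  qed
  ultimately show thesis by (rule that)
qed

section \<open>Iterates and left compositions\<close>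

lemma continuous_map_funpow: "continuous_map T T f \<Longrightarrow> continuous_map T T (f ^^ n)"
  by (induction n) (simp_all add: continuous_map_compose)

lemma open_map_funpow: "open_map T T f \<Longrightarrow> open_map T T (f ^^ n)"
  by (induction n) (simp_all add: open_map_id open_map_compose)

lemma left_ifs_in_Hol:
  assumes "riemann_surface X" "\<And>\<nu>. f \<nu> \<in> Hol X X"
  shows "left_ifs X f \<nu> \<in> Hol X X"
  by (induction \<nu>) (auto intro: Hol_compose assms)

lemma left_ifs_Suc_image:
  "A \<subseteq> points X \<Longrightarrow> left_ifs X f (Suc \<nu>) ` A = f (Suc \<nu>) ` left_ifs X f \<nu> ` A"
  by (auto simp: compose_def image_iff subset_iff)

text \<open>The radii in the proof: the sets \<open>p ` cball 0 (r n)\<close> exhaust \<open>X\<close>, the maps \<open>f 0, \<dots>, f n\<close>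
  send \<open>p ` cball 0 (r n)\<close> into \<open>p ` cball 0 (s n)\<close> whatever they are, and the increase from
  \<open>t n k\<close> to \<open>t n (Suc k)\<close> is the room left for \<open>f (Suc (n + k))\<close> to deviate from \<open>F\<close>.\<close>

lemma left_ifs_dominated:
  assumes X: "riemann_surface X" and p: "universal_covering unit_disk X p" and F: "F \<in> Hol X X"
    and opn: "open_map (topo X) (topo X) F"
  obtains \<U> :: "nat \<Rightarrow> ('a \<Rightarrow> 'a) set"
  where "\<forall>\<nu>. openin (Hol_topology X X) (\<U> \<nu>) \<and> F \<in> \<U> \<nu>"
    "\<forall>f. (\<forall>\<nu>. f \<nu> \<in> \<U> \<nu>) \<longrightarrow> (\<forall>K. compactin (topo X) K \<longrightarrow>
       (\<exists>n C. compactin (topo X) C \<and> (\<forall>k. left_ifs X f (n + k) ` K \<subseteq> (F ^^ k) ` C)))"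
proof -
  have cov: "covering_map (topo unit_disk) (topo X) p"
    using p by (auto simp: universal_covering_def)
  have cp: "continuous_map (topo unit_disk) (topo X) p" and onto: "p ` ball 0 1 = points X"
    using cov by (auto simp: covering_map_def topo_unit_disk)
  have cF: "continuous_map (topo X) (topo X) (F ^^ k)" for k
    by (rule continuous_map_funpow[OF Hol_continuous_map[OF F]])
  have oF: "open_map (topo X) (topo X) (F ^^ k)" for k
    by (rule open_map_funpow[OF opn])
  have Qc: "compactin (topo X) (p ` cball 0 r)" if "r < 1" for r
  proof (rule image_compactin[OF _ cp])
    show "compactin (topo unit_disk) (cball 0 r)"
      unfolding topo_unit_disk compactin_subtopology using that by auto
  qed
  have Qp: "p ` cball 0 r \<subseteq> points X" if "r < 1" for r
    using compactin_subset_topspace[OF Qc[OF that]] .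
  have Oo: "openin (topo X) (p ` ball 0 r)" if "r \<le> 1" for r
  proof -
    have "openin (topo unit_disk) (ball 0 r)"
      unfolding topo_unit_disk using that by (intro open_subset) auto
    then show ?thesis using covering_map_open_map[OF cov] by (simp add: open_map_def)
  qed
  obtain N where N: "openin (Hol_topology X X) N" "F \<in> N"
    "\<forall>r. 0 \<le> r \<and> r < 1 \<longrightarrow> (\<exists>R. 0 \<le> R \<and> R < 1 \<and> (\<forall>f\<in>N. f ` p ` cball 0 r \<subseteq> p ` cball 0 R))"
    by (rule Hol_locally_bounded[OF X p F])
  \<comment> \<open>One radius \<open>B r\<close> works for all maps in \<open>N\<close>
    simultaneously, so iterating \<open>B\<close> bounds compositions of arbitrary members of
    \<open>N\<close>.\<close>
  from N(3) obtain B where B: "\<And>r. 0 \<le> r \<Longrightarrow> r < 1 \<Longrightarrow> 0 \<le> B r \<and> B r < 1"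
    "\<And>r f. 0 \<le> r \<Longrightarrow> r < 1 \<Longrightarrow> f \<in> N \<Longrightarrow> f ` p ` cball 0 r \<subseteq> p ` cball 0 (B r)"
    by metis
  have Bm: "0 \<le> (B ^^ m) r \<and> (B ^^ m) r < 1" if "0 \<le> r" "r < 1" for m r
    using that by (induction m) (auto simp: B(1))
  define r where "r n = 1 - 1 / (real n + 1)" for n
  have r: "0 \<le> r n" "r n < 1" for n by (auto simp: r_def field_simps)
  \<comment> \<open>\<open>left_ifs X f n\<close> has \<open>n + 1\<close> factors, hence the
    exponent \<open>Suc n\<close>.\<close>
  define s where "s n = (B ^^ Suc n) (r n)" for n
  have s: "0 \<le> s n" "s n < 1" for n unfolding s_def using Bm[OF r] by blast+
  \<comment> \<open>The radii start at \<open>s n\<close> and increase strictly towards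
    \<open>t' n\<close>, the midpoint of \<open>s n\<close> and 1, which bounds them all and is
    still below 1.\<close>
  define t where "t n k = s n + (1 - s n) / 2 * (1 - 1 / (real k + 1))" for n k
  define t' where "t' n = s n + (1 - s n) / 2" for n
  have t0: "t n 0 = s n" for n by (simp add: t_def)
  have t_less: "t n k < t n (Suc k)" for n k
    unfolding t_def using s[of n] by (intro add_strict_left_mono mult_strict_left_mono) (auto simp: field_simps)
  have tt': "t n k \<le> t' n" for n k
    unfolding t_def t'_def using s[of n] by (intro add_left_mono mult_left_le) auto
  have t': "t' n < 1" for n using s[of n] by (simp add: t'_def field_simps)
  have t1: "t n k < 1" for n k using tt' t' le_less_trans by blast
  \<comment> \<open>With \<open>k = \<nu> - Suc n\<close>, this compares the step made by
    \<open>f \<nu>\<close> with the step from \<open>F ^^ k\<close> to \<open>F ^^ Suc k\<close>,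
    allowing the disk to grow. The target is open because iterates of \<open>F\<close> are open
    maps.\<close>
  define G where "G \<nu> n = {f \<in> Hol X X. f ` (F ^^ (\<nu> - Suc n)) ` p ` cball 0 (t n (\<nu> - Suc n))
    \<subseteq> (F ^^ Suc (\<nu> - Suc n)) ` p ` ball 0 (t n (Suc (\<nu> - Suc n)))}" for \<nu> n
  \<comment> \<open>Only finitely many \<open>n\<close> impose conditions, and for them
    \<open>n + Suc (\<nu> - Suc n) = \<nu>\<close>. Intersecting with the \<open>topspace\<close>
    takes care of \<open>\<nu> = 0\<close>, where the family is empty.\<close>
  define \<U> where "\<U> \<nu> = N \<inter> ((\<Inter>n\<in>{..<\<nu>}. G \<nu> n) \<inter> topspace (Hol_topology X X))" for \<nu>
  have oG: "openin (Hol_topology X X) (G \<nu> n)" for \<nu> n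
    unfolding G_def
  proof (rule openin_Hol_topology_subbasis)
    show "compactin (topo X) ((F ^^ (\<nu> - Suc n)) ` p ` cball 0 (t n (\<nu> - Suc n)))"
      by (rule image_compactin[OF Qc[OF t1] cF])
    show "openin (topo X) ((F ^^ Suc (\<nu> - Suc n)) ` p ` ball 0 (t n (Suc (\<nu> - Suc n))))"
      using oF Oo[OF less_imp_le[OF t1]] unfolding open_map_def by blast
  qed
  have oU: "openin (Hol_topology X X) (\<U> \<nu>)" for \<nu>
    unfolding \<U>_def by (intro openin_Int[OF N(1)] openin_INT oG) auto
  have FU: "F \<in> \<U> \<nu>" for \<nu>
  proof -
    have "F \<in> G \<nu> n" for n
    proof -
      define k where "k = \<nu> - Suc n"
      \<comment> \<open>Strict growth of the radii is what lets \<open>F\<close> itself satisfy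
        every condition.\<close>
      have "cball 0 (t n k) \<subseteq> ball (0::complex) (t n (Suc k))" using t_less[of n k] by auto
      then have "(F ^^ Suc k) ` p ` cball 0 (t n k) \<subseteq> (F ^^ Suc k) ` p ` ball 0 (t n (Suc k))"
        by (intro image_mono)
      then show ?thesis using F by (simp add: G_def k_def image_comp)
    qed
    then show ?thesis using F N(2) by (simp add: \<U>_def topspace_Hol_topology)
  qed
  have dom: "\<exists>n C. compactin (topo X) C \<and> (\<forall>k. left_ifs X f (n + k) ` K \<subseteq> (F ^^ k) ` C)"
    if f: "\<forall>\<nu>. f \<nu> \<in> \<U> \<nu>" and K: "compactin (topo X) K" for f K
  proof -
    have fN: "f \<nu> \<in> N" for \<nu> using f by (auto simp: \<U>_def)
    have first: "left_ifs X f m ` p ` cball 0 \<rho> \<subseteq> p ` cball 0 ((B ^^ Suc m) \<rho>)"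
      if "0 \<le> \<rho>" "\<rho> < 1" for m \<rho>
    proof (induction m)
      case 0
      then show ?case using B(2)[OF that fN, of 0] by simp
    next
      case (Suc m)
      have "left_ifs X f (Suc m) ` p ` cball 0 \<rho> \<subseteq> f (Suc m) ` p ` cball 0 ((B ^^ Suc m) \<rho>)"
        unfolding left_ifs_Suc_image[OF Qp[OF that(2)]] by (rule image_mono[OF Suc])
      also have "\<dots> \<subseteq> p ` cball 0 ((B ^^ Suc (Suc m)) \<rho>)"
        using B(2)[OF _ _ fN, of "(B ^^ Suc m) \<rho>"] Bm[OF that, of "Suc m"] by simp
      finally show ?case .
    qed
    \<comment> \<open>From index \<open>n\<close> on, compositions are compared with iterates of
      \<open>F\<close>: the radius \<open>s n\<close> starts the induction, and membership in
      \<open>G (Suc (n + k)) n\<close> gives each step.\<close>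
    have later: "left_ifs X f (n + k) ` p ` cball 0 (r n) \<subseteq> (F ^^ k) ` p ` cball 0 (t n k)" for n k
    proof (induction k)
      case 0
      then show ?case using first[OF r, of n n] by (simp add: t0 s_def)
    next
      case (Suc k)
      have "f (Suc (n + k)) \<in> G (Suc (n + k)) n" using f[rule_format, of "Suc (n + k)"] by (simp add: \<U>_def)
      then have G: "f (Suc (n + k)) ` (F ^^ k) ` p ` cball 0 (t n k) \<subseteq> (F ^^ Suc k) ` p ` ball 0 (t n (Suc k))"
        by (simp add: G_def)
      have "left_ifs X f (n + Suc k) ` p ` cball 0 (r n) \<subseteq> f (Suc (n + k)) ` (F ^^ k) ` p ` cball 0 (t n k)"
        unfolding add_Suc_right left_ifs_Suc_image[OF Qp[OF r(2)]] by (rule image_mono[OF Suc])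
      also note G
      also have "(F ^^ Suc k) ` p ` ball 0 (t n (Suc k)) \<subseteq> (F ^^ Suc k) ` p ` cball 0 (t n (Suc k))"
        by (intro image_mono ball_subset_cball)
      finally show ?case .
    qed
    obtain \<rho> where \<rho>: "0 \<le> \<rho>" "\<rho> < 1" "K \<subseteq> p ` cball 0 \<rho>"
      by (rule compactin_subset_image_cball[OF cov K])
    \<comment> \<open>This makes \<open>1 / (n + 1)\<close> smaller than \<open>1 - \<rho>\<close>,
      so that \<open>r n\<close> exceeds \<rho>.\<close>
    obtain n :: nat where "1 / (1 - \<rho>) < n" using reals_Archimedean2 by blast
    then have "\<rho> \<le> r n" using \<rho>(2) by (simp add: r_def field_simps)
    then have Kr: "K \<subseteq> p ` cball 0 (r n)" using \<rho>(3) by fastforce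
    have "left_ifs X f (n + k) ` K \<subseteq> (F ^^ k) ` p ` cball 0 (t' n)" for k
    proof -
      have "left_ifs X f (n + k) ` K \<subseteq> left_ifs X f (n + k) ` p ` cball 0 (r n)"
        by (rule image_mono[OF Kr])
      also note later
      also have "(F ^^ k) ` p ` cball 0 (t n k) \<subseteq> (F ^^ k) ` p ` cball 0 (t' n)"
        using tt'[of n k] by (intro image_mono) auto
      finally show ?thesis .
    qed
    then show ?thesis using Qc[OF t'] by blast
  qed
  show thesis by (rule that[of \<U>]) (use oU FU dom in blast)+
qed

text \<open>If \<open>F\<close> were constantly \<open>c\<close>, every iterate except the zeroth
  would send a given point to \<open>c\<close>, and its images would keep meeting the compact set
  \<open>{c}\<close>.\<close>

lemma compactly_divergent_iterates_nonconstant: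
  assumes "points X \<noteq> {}" and F: "F \<in> Hol X X" and cd: "compactly_divergent X (iterates X F)"
  shows "\<exists>x\<in>points X. F x \<noteq> c"
proof (rule ccontr)
  assume "\<not> ?thesis"
  then have c: "\<And>x. x \<in> points X \<Longrightarrow> F x = c" by blast
  obtain x where x: "x \<in> points X" using assms by blast
  have Fn: "(F ^^ n) x \<in> points X" for n
    using x by (induction n) (auto intro: Hol_in_points[OF F])
  have "compactin (topo X) {x}" "compactin (topo X) {c}"
    using x c[OF x] Hol_in_points[OF F x] by auto
  with cd obtain \<nu>\<^sub>0 where "\<forall>\<nu>\<ge>\<nu>\<^sub>0. iterates X F \<nu> ` {x} \<inter> {c} = {}"
    unfolding compactly_divergent_def by meson
  then have "iterates X F (Suc \<nu>\<^sub>0) x \<noteq> c" by (auto dest: spec[of _ "Suc \<nu>\<^sub>0"])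
  then show False using c[OF Fn[of \<nu>\<^sub>0]] x by (simp add: iterates_def)
qed

section \<open>Divergence and convergence of the left iterated function system\<close>

theorem theorem1p7:
  fixes X :: "'a surface" and F :: "'a \<Rightarrow> 'a"
  assumes "hyperbolic X"
    and "F \<in> Hol X X"
    and "compactly_divergent X (iterates X F)"
  shows "\<exists>\<U> :: nat \<Rightarrow> ('a \<Rightarrow> 'a) set.
    (\<forall>\<nu>. \<U> \<nu> \<subseteq> Hol X X \<and> F \<in> Hol_topology X X interior_of \<U> \<nu>) \<and>
    (\<forall>f. (\<forall>\<nu>. f \<nu> \<in> \<U> \<nu> \<and> f \<nu> \<noteq> restrict id (points X)) \<longrightarrow>
       compactly_divergent X (left_ifs X f) \<and>
       (\<forall>(Xh :: 'a surface) \<tau>.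
          riemann_surface Xh \<and> compact_space (topo Xh) \<and> domain_in X Xh \<and>
          \<tau> \<in> topo Xh frontier_of points X \<and>
          converges_to_point X Xh (iterates X F) \<tau> \<longrightarrow>
            converges_to_point X Xh (left_ifs X f) \<tau>))"
proof -
  obtain p where X: "riemann_surface X" and p: "universal_covering unit_disk X p"
    using assms(1) by (auto simp: hyperbolic_def)
  have "points X \<noteq> {}" using X by (simp add: riemann_surface_def)
  then have opn: "open_map (topo X) (topo X) F"
    using compactly_divergent_iterates_nonconstant[OF _ assms(2,3)]
    by (intro Hol_open_map[OF X p assms(2)]) blast
  obtain \<U> where \<U>: "\<forall>\<nu>. openin (Hol_topology X X) (\<U> \<nu>) \<and> F \<in> \<U> \<nu>"
    and dom: "\<forall>f. (\<forall>\<nu>. f \<nu> \<in> \<U> \<nu>) \<longrightarrow> (\<forall>K. compactin (topo X) K \<longrightarrow>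
       (\<exists>n C. compactin (topo X) C \<and> (\<forall>k. left_ifs X f (n + k) ` K \<subseteq> (F ^^ k) ` C)))"
    by (rule left_ifs_dominated[OF X p assms(2) opn])
  have sub: "\<U> \<nu> \<subseteq> Hol X X" for \<nu>
    using \<U> openin_subset topspace_Hol_topology by metis
  have int: "F \<in> Hol_topology X X interior_of \<U> \<nu>" for \<nu>
    using \<U> by (metis interior_of_openin)
  have iter: "iterates X F k ` C = (F ^^ k) ` C" if "compactin (topo X) C" for k C
    using compactin_subset_topspace[OF that] by (auto simp: iterates_def subset_iff image_iff)
  have "compactly_divergent X (left_ifs X f)" if f: "\<forall>\<nu>. f \<nu> \<in> \<U> \<nu>" for f
    unfolding compactly_divergent_def
  proof (intro allI impI, elim conjE)
    fix K L assume K: "compactin (topo X) K" and L: "compactin (topo X) L"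
    obtain n C where C: "compactin (topo X) C" "\<forall>k. left_ifs X f (n + k) ` K \<subseteq> (F ^^ k) ` C"
      using dom f K by meson
    obtain m where m: "\<forall>\<nu>\<ge>m. iterates X F \<nu> ` C \<inter> L = {}"
      using assms(3) C(1) L unfolding compactly_divergent_def by meson
    \<comment> \<open>For these indices the image of \<open>K\<close> lies in that of
      \<open>C\<close> under \<open>F ^^ (\<nu> - n)\<close>, where
      \<open>\<nu> - n \<ge> m\<close>.\<close>
    have "left_ifs X f \<nu> ` K \<inter> L = {}" if "\<nu> \<ge> n + m" for \<nu>
    proof -
      have "left_ifs X f (n + (\<nu> - n)) ` K \<subseteq> (F ^^ (\<nu> - n)) ` C" using C(2) by blast
      moreover have "(F ^^ (\<nu> - n)) ` C \<inter> L = {}" using m[rule_format, of "\<nu> - n"] that iter[OF C(1)] by simp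
      ultimately show ?thesis using that by auto
    qed
    then show "\<exists>\<nu>\<^sub>0. \<forall>\<nu>\<ge>\<nu>\<^sub>0. left_ifs X f \<nu> ` K \<inter> L = {}" by blast
  qed
  moreover have "converges_to_point X Xh (left_ifs X f) \<tau>"
    if f: "\<forall>\<nu>. f \<nu> \<in> \<U> \<nu>" and Xh: "domain_in X Xh" and conv: "converges_to_point X Xh (iterates X F) \<tau>"
    for f and Xh :: "'a surface" and \<tau>
    unfolding converges_to_point_def Hol_topology_def
  \<comment> \<open>On a subbasic set, convergence means that the images of one compact
    \<open>K\<close> eventually lie in one open \<open>V\<close>.\<close>
  proof (rule limitin_topology_generated_by)
    let ?c = "restrict (\<lambda>_. \<tau>) (points X)"
    have cH: "?c \<in> topspace (Hol_topology X Xh)"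
      using conv by (simp add: converges_to_point_def limitin_def)
    then show "?c \<in> \<Union>{{f \<in> Hol X Xh. f ` K \<subseteq> V} |K V. compactin (topo X) K \<and> openin (topo Xh) V}"
      by (simp add: Hol_topology_def)
    fix S assume "S \<in> {{f \<in> Hol X Xh. f ` K \<subseteq> V} |K V. compactin (topo X) K \<and> openin (topo Xh) V}"
      and cS: "?c \<in> S"
    then obtain K V where K: "compactin (topo X) K" and V: "openin (topo Xh) V"
      and S: "S = {f \<in> Hol X Xh. f ` K \<subseteq> V}"
      by blast
    have LH: "left_ifs X f \<nu> \<in> Hol X Xh" for \<nu>
      using left_ifs_in_Hol[OF X] f sub domain_in_Hol_subset[OF Xh] by blast
    obtain n C where C: "compactin (topo X) C" "\<forall>k. left_ifs X f (n + k) ` K \<subseteq> (F ^^ k) ` C"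
      using dom f K by meson
    show "eventually (\<lambda>\<nu>. left_ifs X f \<nu> \<in> S) sequentially"
    \<comment> \<open>Membership of the constant map in \<open>S\<close> yields
      \<open>\<tau> \<in> V\<close> only for nonempty \<open>K\<close>; for empty \<open>K\<close>
      the condition on the maps is vacuous.\<close>
    proof (cases "K = {}")
      case True
      then show ?thesis using LH by (simp add: S)
    next
      case False
      then have "\<tau> \<in> V" using cS compactin_subset_topspace[OF K] by (auto simp: S)
      \<comment> \<open>Convergence of the iterates is applied to \<open>C\<close> in place of
        \<open>K\<close>, since the images of \<open>C\<close> contain those of \<open>K\<close>
        under the left compositions.\<close>
      then have "?c \<in> {f \<in> Hol X Xh. f ` C \<subseteq> V}"
        using cH compactin_subset_topspace[OF C(1)] by (auto simp: topspace_Hol_topology)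
      moreover have "openin (Hol_topology X Xh) {f \<in> Hol X Xh. f ` C \<subseteq> V}"
        by (rule openin_Hol_topology_subbasis[OF C(1) V])
      ultimately have "eventually (\<lambda>k. iterates X F k \<in> {f \<in> Hol X Xh. f ` C \<subseteq> V}) sequentially"
        using conv unfolding converges_to_point_def limitin_def by blast
      then obtain m where m: "\<forall>k\<ge>m. iterates X F k ` C \<subseteq> V"
        unfolding eventually_sequentially by blast
      have "left_ifs X f \<nu> ` K \<subseteq> V" if "\<nu> \<ge> n + m" for \<nu>
      proof -
        have "left_ifs X f (n + (\<nu> - n)) ` K \<subseteq> (F ^^ (\<nu> - n)) ` C" using C(2) by blast
        also have "\<dots> \<subseteq> V" using m[rule_format, of "\<nu> - n"] that iter[OF C(1)] by simp
        finally show ?thesis using that by simp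
      qed
      then show ?thesis unfolding eventually_sequentially S using LH by blast
    qed
  qed
  ultimately show ?thesis using sub int by (intro exI[of _ \<U>]) blast
qed

end
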